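(* Let $l_1,l_2,l_3>0$ with $l_1+l_2+l_3=1$ and $\tau\in[0,1)$, and let $F=F_{\tau,l_1,l_2,l_3}:\mathbb S^1\to\mathbb S^1$ be the fully flipped $3$-interval exchange transformation of the circle with these parameters. If $F$ is minimal, then $\tau=\frac12$.
   Context: $\mathbb S^1=\mathbb R/\mathbb Z$. Put $a_0=0$, $a_1=l_1$, $a_2=l_1+l_2$, $a_3=1$. The map $F_{\tau,l_1,l_2,l_3}$ is defined by $F(x)=-x+a_{i-1}+a_i+\tau \bmod 1$ for $x\in[a_{i-1},a_i)$, $i=1,2,3$: each interval $[a_{i-1},a_i)$ is flipped and shifted by $\tau$. Minimal means that every orbit (of a point whose orbit avoids the finitely many singular points) is dense in $\mathbb S^1$. *)

theory Defs
  imports "HOL-Analysis.Analysis"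
begin

quotient_type circle = real / "\<lambda>x y. x - y \<in> \<int>"
  morphisms rep_circle to_circle
proof (rule equivpI)
  show "reflp (\<lambda>x y::real. x - y \<in> \<int>)" by (simp add: reflp_def)
  show "symp (\<lambda>x y::real. x - y \<in> \<int>)" by (rule sympI) (use Ints_minus in fastforce)
  show "transp (\<lambda>x y::real. x - y \<in> \<int>)"
  proof (rule transpI)
    fix x y z :: real
    assume "x - y \<in> \<int>" "y - z \<in> \<int>"
    then have "(x - y) + (y - z) \<in> \<int>" by (rule Ints_add)
    then show "x - z \<in> \<int>" by simp
  qed
qed

instantiation circle :: topological_space
begin

definition open_circle :: "circle set \<Rightarrow> bool"
  where "open_circle U \<longleftrightarrow> open (to_circle -` U)"

instance
  by standard (auto simp: open_circle_def vimage_Union)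

end

lemma to_circle_eq_iff: "to_circle x = to_circle y \<longleftrightarrow> x - y \<in> \<int>"
  by (rule circle.abs_eq_iff)

lift_definition unit_rep :: "circle \<Rightarrow> real" is frac
proof -
  fix x y :: real
  assume "x - y \<in> \<int>"
  then obtain k where "x = y + of_int k" by (auto elim!: Ints_cases simp: algebra_simps)
  then show "frac x = frac y" by (simp add: frac_def)
qed

lemma unit_rep_to_circle: "0 \<le> x \<Longrightarrow> x < 1 \<Longrightarrow> unit_rep (to_circle x) = x"
  by (simp add: unit_rep.abs_eq frac_eq)

lemma unit_rep_ge_0: "0 \<le> unit_rep p" and unit_rep_less_1: "unit_rep p < 1"
  by (transfer, simp add: frac_lt_1)+

lemma to_circle_unit_rep: "to_circle (unit_rep p) = p"
  by (induction p) (simp add: unit_rep.abs_eq to_circle_eq_iff frac_def)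

definition endpt :: "real \<Rightarrow> real \<Rightarrow> real \<Rightarrow> nat \<Rightarrow> real"
  where "endpt l1 l2 l3 i = [0, l1, l1 + l2, 1] ! i"

text \<open>The parameter \<open>l3\<close> does not occur on the right-hand side, since the
  lengths are meant to sum to 1.\<close>

definition flip_iet :: "real \<Rightarrow> real \<Rightarrow> real \<Rightarrow> real \<Rightarrow> circle \<Rightarrow> circle"
  where "flip_iet \<tau> l1 l2 l3 p =
    (let x = unit_rep p;
         a = endpt l1 l2 l3;
         i = (if x < a 1 then 1 else if x < a 2 then 2 else 3)
     in to_circle (- x + a (i - 1) + a i + \<tau>))"

definition singular_points :: "real \<Rightarrow> real \<Rightarrow> real \<Rightarrow> circle set"
  where "singular_points l1 l2 l3 = (\<lambda>i. to_circle (endpt l1 l2 l3 i)) ` {0..3}"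

text \<open>The two-sided orbit of a point under a bijection (see \<open>bij_flip_iet\<close> below).\<close>

definition orbit_of :: "('a \<Rightarrow> 'a) \<Rightarrow> 'a \<Rightarrow> 'a set"
  where "orbit_of f x = {y. \<exists>n. y = (f ^^ n) x \<or> x = (f ^^ n) y}"

definition minimal_off :: "'a::topological_space set \<Rightarrow> ('a \<Rightarrow> 'a) \<Rightarrow> bool"
  where "minimal_off S f \<longleftrightarrow>
    (\<forall>x. orbit_of f x \<inter> S = {} \<longrightarrow> closure (orbit_of f x) = UNIV)"

lemma endpt_simps [simp]:
  "endpt l1 l2 l3 0 = 0" "endpt l1 l2 l3 (Suc 0) = l1"
  "endpt l1 l2 l3 2 = l1 + l2" "endpt l1 l2 l3 3 = 1"
  by (simp_all add: endpt_def eval_nat_numeral)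

lemma flip_iet_eq:
  assumes "l1 > 0" "l2 > 0" "l3 > 0" "l1 + l2 + l3 = 1" "i \<in> {1..3}"
    and "x \<in> {endpt l1 l2 l3 (i - 1)..<endpt l1 l2 l3 i}"
  shows "flip_iet \<tau> l1 l2 l3 (to_circle x) =
    to_circle (- x + endpt l1 l2 l3 (i - 1) + endpt l1 l2 l3 i + \<tau>)"
proof -
  have "i = 1 \<or> i = 2 \<or> i = 3" using assms(5) by auto
  then have x01: "0 \<le> x" "x < 1" using assms by auto
  from \<open>i = 1 \<or> i = 2 \<or> i = 3\<close> show ?thesis
    using assms x01 by (auto simp: flip_iet_def Let_def unit_rep_to_circle)
qed

lemma bij_flip_iet:
  assumes l: "l1 > 0" "l2 > 0" "l3 > 0" "l1 + l2 + l3 = 1"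
  shows "bij (flip_iet \<tau> l1 l2 l3)"
proof (rule bijI)
  let ?s = "\<lambda>x. if x < l1 then l1 else if x < l1 + l2 then l1 + (l1 + l2) else l1 + l2 + 1"
  have F: "flip_iet \<tau> l1 l2 l3 p = to_circle (- unit_rep p + ?s (unit_rep p) + \<tau>)" for p
    by (simp add: flip_iet_def Let_def algebra_simps)
  show "inj (flip_iet \<tau> l1 l2 l3)"
  proof (rule injI)
    fix p q
    assume eq: "flip_iet \<tau> l1 l2 l3 p = flip_iet \<tau> l1 l2 l3 q"
    define x y where "x = unit_rep p" and "y = unit_rep q"
    have xy: "0 \<le> x" "x < 1" "0 \<le> y" "y < 1"
      by (simp_all add: x_def y_def unit_rep_ge_0 unit_rep_less_1)
    have "(- x + ?s x + \<tau>) - (- y + ?s y + \<tau>) \<in> \<int>"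
      using eq by (simp only: F to_circle_eq_iff x_def y_def)
    then obtain k :: int where k: "(- x + ?s x + \<tau>) - (- y + ?s y + \<tau>) = of_int k"
      by (auto elim: Ints_cases)
    then have "of_int k < (1::real)" "(-1::real) < of_int k"
      using xy l by (auto split: if_splits)
    then have "k = 0" by linarith
    then have "x = y" using k xy l by (auto split: if_splits)
    then show "p = q" by (metis to_circle_unit_rep x_def y_def)
  qed
  show "surj (flip_iet \<tau> l1 l2 l3)"
  proof (rule surjI)
    fix q
    define w where "w = 1 - frac (\<tau> - unit_rep q)"
    define x where "x = - w + (if w \<le> l1 then l1 else if w \<le> l1 + l2 then l1 + (l1 + l2) else l1 + l2 + 1)"
    have w: "0 < w" "w \<le> 1" by (simp_all add: w_def frac_lt_1)
    have x: "0 \<le> x" "x < 1" using w l by (auto simp: x_def)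
    have "- x + ?s x = w" using w l by (auto simp: x_def)
    then have "flip_iet \<tau> l1 l2 l3 (to_circle x) = to_circle (w + \<tau>)"
      by (simp only: F unit_rep_to_circle[OF x])
    also have "\<dots> = to_circle (unit_rep q)"
      by (simp add: to_circle_eq_iff w_def frac_def)
    finally show "flip_iet \<tau> l1 l2 l3 (to_circle (- (1 - frac (\<tau> - unit_rep q)) +
        (if 1 - frac (\<tau> - unit_rep q) \<le> l1 then l1
         else if 1 - frac (\<tau> - unit_rep q) \<le> l1 + l2 then l1 + (l1 + l2) else l1 + l2 + 1))) = q"
      by (simp only: x_def w_def to_circle_unit_rep)
  qed
qed

end

theory Submission
  imports Defs
begin

text \<open>Let the circle have length \<open>L = l1 + l2 + l3\<close> and put \<open>d = \<tau> - L/2\<close>. If some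
  interval is longer than \<open>min \<tau> (L - \<tau>) = L/2 - \<bar>d\<bar>\<close>, then the map has a fixed point inside it;
  being reversed there, a whole neighbourhood consists of points of period two. Otherwise let
  \<open>l1\<close> be the shortest interval. Then \<open>I\<^sub>1 \<union> F\<^sup>-\<^sup>1 I\<^sub>1\<close> is a single arc of length \<open>2 * l1\<close>; collapsing
  it to a point, the first return map to the rest is again a fully flipped exchange, with lengths
  \<open>(l1, l2 - l1, l3 - l1)\<close>, rotation \<open>\<tau> - l1\<close> and the same \<open>d\<close>. Each such step shortens
  the circle by \<open>2 * l1 \<ge> 4 * \<bar>d\<bar>\<close>, so for \<open>d \<noteq> 0\<close> a finite number of steps leads to the first case,
  and the map has periodic points off any given countable set.\<close>

section \<open>The exchange on an interval of arbitrary length, and its periodic cycles\<close>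

text \<open>The total length \<open>L\<close> stays free because the induction shortens the circle.
  For \<open>x\<close> in \<open>[0, L)\<close> and \<open>0 \<le> \<tau> < L\<close> the unreduced
  value lies in \<open>(0, 2 * L)\<close>, so subtracting \<open>L\<close> once suffices.\<close>

definition flip_lift :: "real \<Rightarrow> real \<Rightarrow> real \<Rightarrow> real \<Rightarrow> real \<Rightarrow> real" where
  "flip_lift \<tau> l1 l2 l3 x =
    (let L = l1 + l2 + l3;
         y = (if x < l1 then l1 else if x < l1 + l2 then 2 * l1 + l2 else l1 + l2 + L) + \<tau> - x
     in if y < L then y else y - L)"

text \<open>Avoiding an arbitrary countable set allows discarding interval endpoints
  (where the half-open conventions do not survive flips) and their preimages under the
  induction. Lengths may be zero: equal shortest intervals make an induced interval empty.\<close>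

definition generic_cycle :: "real \<Rightarrow> real \<Rightarrow> real \<Rightarrow> real \<Rightarrow> bool" where
  "generic_cycle \<tau> l1 l2 l3 \<longleftrightarrow>
    (\<forall>B. countable B \<longrightarrow> (\<exists>C. finite C \<and> C \<noteq> {} \<and> C \<subseteq> {0..<l1 + l2 + l3} \<and> C \<inter> B = {} \<and>
      flip_lift \<tau> l1 l2 l3 ` C \<subseteq> C))"

lemma generic_cycleD:
  assumes "generic_cycle \<tau> l1 l2 l3" "countable B"
  obtains C where "finite C" "C \<noteq> {}" "C \<subseteq> {0..<l1 + l2 + l3}" "C \<inter> B = {}"
    "\<And>x. x \<in> C \<Longrightarrow> flip_lift \<tau> l1 l2 l3 x \<in> C"
proof -
  obtain C where "finite C" "C \<noteq> {}" "C \<subseteq> {0..<l1 + l2 + l3}" "C \<inter> B = {}"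
    and "flip_lift \<tau> l1 l2 l3 ` C \<subseteq> C"
    using assms unfolding generic_cycle_def by metis
  then show thesis by (intro that) auto
qed

lemma flip_lift_left:
  assumes "x < l1" "l1 + \<tau> - x < l1 + l2 + l3"
  shows "flip_lift \<tau> l1 l2 l3 x = l1 + \<tau> - x"
  using assms by (simp add: flip_lift_def Let_def)

lemma flip_lift_middle:
  assumes "l1 \<le> x" "x < l1 + l2" "2 * l1 + l2 + \<tau> - x < l1 + l2 + l3"
  shows "flip_lift \<tau> l1 l2 l3 x = 2 * l1 + l2 + \<tau> - x"
  using assms by (simp add: flip_lift_def Let_def)

lemma flip_lift_middle_wrap:
  assumes "l1 \<le> x" "x < l1 + l2" "l1 + l2 + l3 \<le> 2 * l1 + l2 + \<tau> - x"
  shows "flip_lift \<tau> l1 l2 l3 x = l1 + \<tau> - x - l3"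
  using assms by (simp add: flip_lift_def Let_def)

lemma flip_lift_right_wrap:
  assumes "l1 \<le> x" "l1 + l2 \<le> x" "x \<le> l1 + l2 + \<tau>"
  shows "flip_lift \<tau> l1 l2 l3 x = l1 + l2 + \<tau> - x"
  using assms by (simp add: flip_lift_def Let_def)

text \<open>The map is covered by six injective affine branches: three intervals, each with or
  without wrapping.\<close>

lemma countable_flip_lift_vimage:
  assumes "countable B"
  shows "countable (flip_lift \<tau> l1 l2 l3 -` B)"
proof -
  let ?L = "l1 + l2 + l3"
  let ?K = "{l1, 2 * l1 + l2, l1 + l2 + ?L}"
  have "flip_lift \<tau> l1 l2 l3 -` B \<subseteq>
    (\<Union>k\<in>?K. (\<lambda>b. k + \<tau> - b) ` B \<union> (\<lambda>b. k + \<tau> - ?L - b) ` B)" (is "_ \<subseteq> ?R")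
  proof
    fix x assume "x \<in> flip_lift \<tau> l1 l2 l3 -` B"
    moreover have "\<exists>k\<in>?K. flip_lift \<tau> l1 l2 l3 x = k + \<tau> - x \<or>
        flip_lift \<tau> l1 l2 l3 x = k + \<tau> - ?L - x"
      by (auto simp: flip_lift_def Let_def)
    ultimately obtain k b where "k \<in> ?K" "b \<in> B" "x = k + \<tau> - b \<or> x = k + \<tau> - ?L - b"
      by force
    then show "x \<in> ?R" by blast
  qed
  moreover have "countable ?R" using assms by (intro countable_UN) auto
  ultimately show ?thesis by (rule countable_subset)
qed

lemma flip_lift_range:
  assumes "l1 \<ge> 0" "l2 \<ge> 0" "l3 \<ge> 0" "0 \<le> \<tau>" "\<tau> < l1 + l2 + l3" "x \<in> {0..<l1 + l2 + l3}"
  shows "flip_lift \<tau> l1 l2 l3 x \<in> {0..<l1 + l2 + l3}"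
  using assms unfolding flip_lift_def Let_def atLeastLessThan_iff
  by (simp only: split: if_split) (safe; linarith)

section \<open>Rotation, long intervals and the induction step\<close>

text \<open>Moving the origin to \<open>l1\<close> permutes the lengths cyclically and keeps
  \<open>\<tau>\<close>; away from interval ends, \<open>\<psi>\<close> conjugates the two
  maps.\<close>

lemma generic_cycle_rotate:
  assumes "l1 \<ge> 0" "l2 \<ge> 0" "l3 \<ge> 0" "0 \<le> \<tau>" "\<tau> \<le> l1 + l2 + l3"
    and "generic_cycle \<tau> l2 l3 l1"
  shows "generic_cycle \<tau> l1 l2 l3"
  unfolding generic_cycle_def
proof (intro allI impI)
  fix B :: "real set" assume B: "countable B"
  let ?L = "l1 + l2 + l3"
  define \<psi> where "\<psi> u = (if u < l2 + l3 then u + l1 else u + l1 - ?L)" for u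
  have "\<psi> -` B \<subseteq> (\<lambda>b. b - l1) ` B \<union> (\<lambda>b. b - l1 + ?L) ` B"
    by (force simp: \<psi>_def image_iff split: if_splits)
  then have "countable (\<psi> -` B)"
    by (rule countable_subset) (use B in auto)
  then have "countable (\<psi> -` B \<union> {0, l2, l2 + l3})" by simp
  from generic_cycleD[OF assms(6) this] obtain C where C: "finite C" "C \<noteq> {}"
    "C \<subseteq> {0..<l2 + l3 + l1}" "C \<inter> (\<psi> -` B \<union> {0, l2, l2 + l3}) = {}"
    "\<And>x. x \<in> C \<Longrightarrow> flip_lift \<tau> l2 l3 l1 x \<in> C" by metis
  have "flip_lift \<tau> l1 l2 l3 (\<psi> u) = \<psi> (flip_lift \<tau> l2 l3 l1 u)" if "u \<in> C" for u
  proof -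
    have u: "0 < u" "u < l2 + l3 + l1" "u \<noteq> l2" "u \<noteq> l2 + l3"
      using that C(3,4) by (auto simp: less_le)
    show ?thesis
      using u assms(1-5) by (simp add: flip_lift_def Let_def \<psi>_def)
  qed
  then have "flip_lift \<tau> l1 l2 l3 ` \<psi> ` C \<subseteq> \<psi> ` C" using C(5) by auto
  moreover have "\<psi> ` C \<subseteq> {0..<?L}" using C(3) assms(1-5) by (auto simp: \<psi>_def)
  moreover have "\<psi> ` C \<inter> B = {}" using C(4) by auto
  ultimately show "\<exists>C. finite C \<and> C \<noteq> {} \<and> C \<subseteq> {0..<?L} \<and> C \<inter> B = {} \<and>
      flip_lift \<tau> l1 l2 l3 ` C \<subseteq> C"
    using C(1,2) by (intro exI[of _ "\<psi> ` C"]) auto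
qed

lemma generic_cycle_long_interval:
  assumes l: "l1 \<ge> 0" "l2 \<ge> 0" "l3 \<ge> 0" "0 \<le> \<tau>" "\<tau> \<le> l1 + l2 + l3"
    and long: "l1 > \<tau> \<or> l1 > l1 + l2 + l3 - \<tau>"
  shows "generic_cycle \<tau> l1 l2 l3"
  unfolding generic_cycle_def
proof (intro allI impI)
  fix B :: "real set" assume B: "countable B"
  let ?L = "l1 + l2 + l3"
  \<comment> \<open>\<open>c\<close> is the fixed point of the first branch, unwrapped or wrapped.
    The branch reflects about \<open>c\<close>, and \<open>e\<close> is the distance from
    \<open>c\<close> to the nearer end of the interval.\<close>
  define c where "c = (if l1 > \<tau> then (l1 + \<tau>) / 2 else (l1 + \<tau> - ?L) / 2)"
  define e where "e = min c (l1 - c)"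
  have e: "e > 0" "e \<le> c" "e \<le> l1 - c" using assms by (auto simp: c_def e_def)
  have "countable ((\<lambda>b. b - c) ` B \<union> (\<lambda>b. c - b) ` B)" using B by auto
  moreover have "uncountable {0<..<e}" using e by (simp add: uncountable_open_interval)
  ultimately obtain t where t: "t \<in> {0<..<e}" "t \<notin> (\<lambda>b. b - c) ` B \<union> (\<lambda>b. c - b) ` B"
    by (meson countable_subset subsetI)
  have "c + t \<notin> B" "c - t \<notin> B" using t(2) by force+
  moreover have "flip_lift \<tau> l1 l2 l3 (c + t) = c - t" "flip_lift \<tau> l1 l2 l3 (c - t) = c + t"
    using assms t(1) e by (auto simp: flip_lift_def Let_def c_def field_simps split: if_splits)
  ultimately show "\<exists>C. finite C \<and> C \<noteq> {} \<and> C \<subseteq> {0..<?L} \<and> C \<inter> B = {} \<and>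
      flip_lift \<tau> l1 l2 l3 ` C \<subseteq> C"
    using t(1) e l by (intro exI[of _ "{c + t, c - t}"]) auto
qed

text \<open>The bounds on \<open>\<tau>\<close> say that \<open>p = \<tau> - l3\<close> lies in
  \<open>[0, l1]\<close>. Up to endpoints, the middle interval then covers \<open>[0, p]\<close>
  from \<open>[l1, l1 + p]\<close>, and the right one covers \<open>[p, l1]\<close> from
  \<open>[L - l1 + p, L]\<close>, so both preimages adjoin \<open>[0, l1]\<close>.\<close>

lemma generic_cycle_induced:
  assumes l: "0 < l1" "l1 \<le> l2" "l1 \<le> l3"
    and \<tau>: "l3 \<le> \<tau>" "\<tau> \<le> l1 + l3"
    and cyc: "generic_cycle (\<tau> - l1) l1 (l2 - l1) (l3 - l1)"
  shows "generic_cycle \<tau> l1 l2 l3"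
  unfolding generic_cycle_def
proof (intro allI impI)
  fix B :: "real set" assume B: "countable B"
  let ?L = "l1 + l2 + l3" and ?g = "flip_lift \<tau> l1 l2 l3"
  let ?h = "flip_lift (\<tau> - l1) l1 (l2 - l1) (l3 - l1)"
  define p where "p = \<tau> - l3"
  have p: "0 \<le> p" "p \<le> l1" using \<tau> by (auto simp: p_def)
  define \<phi> where "\<phi> u = (if u < p then u - l1 + ?L else u + l1)" for u
  have \<phi>_countable: "countable (\<phi> -` X)" if "countable X" for X
  proof -
    have "\<phi> -` X \<subseteq> (\<lambda>b. b + l1 - ?L) ` X \<union> (\<lambda>b. b - l1) ` X"
      by (force simp: \<phi>_def image_iff split: if_splits)
    then show ?thesis by (rule countable_subset) (use that in auto)
  qed
  \<comment> \<open>\<open>\<phi>\<close> sends the collapsed circle back to the large one, opening it at \<open>p\<close>; the return time is 3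
      on the first induced interval and 1 elsewhere.\<close>
  let ?B = "\<phi> -` (B \<union> ?g -` B \<union> ?g -` ?g -` B) \<union> {0, l1, l2, p}"
  have "countable ?B"
    using B by (intro countable_Un \<phi>_countable countable_flip_lift_vimage) auto
  from generic_cycleD[OF cyc this] obtain C where C: "finite C" "C \<noteq> {}"
    "C \<subseteq> {0..<l1 + (l2 - l1) + (l3 - l1)}" "C \<inter> ?B = {}"
    "\<And>x. x \<in> C \<Longrightarrow> ?h x \<in> C" by metis
  have u: "0 < u" "u < l2 + l3 - l1" "u \<noteq> l1" "u \<noteq> l2" "u \<noteq> p" if "u \<in> C" for u
    using that C(3,4) by (auto simp: less_le)
  let ?w = "\<lambda>y. if y < l2 + l3 - l1 then y else y - (l2 + l3 - l1)"
  \<comment> \<open>On a window of one induced length starting at \<open>p\<close>, opening the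
    circle is translation by \<open>l1\<close>; the wrap of \<open>?h\<close> disappears.\<close>
  have \<phi>_wrap: "\<phi> (?w y) = y + l1" if "p \<le> y" "y < l2 + l3 - l1 + p" for y
    using that by (simp add: \<phi>_def)
  have far: "?g (\<phi> u) = \<phi> (?h u)" if "u \<in> C" "u > l1" for u
  proof -
    note u = u(1,2)[OF that(1)] that(2)
    have \<phi>u: "\<phi> u = u + l1" using u p by (simp add: \<phi>_def)
    show ?thesis
    proof (cases "u < l2")
      case True
      have "?h u = ?w (l2 + \<tau> - u)"
        using u True by (simp add: flip_lift_def Let_def)
      moreover have "\<phi> (?w (l2 + \<tau> - u)) = l2 + \<tau> - u + l1"
        using u True l \<tau> unfolding p_def by (intro \<phi>_wrap[unfolded p_def]; linarith)
      moreover have "?g (u + l1) = 2 * l1 + l2 + \<tau> - (u + l1)"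
        using u True l p unfolding p_def by (intro flip_lift_middle; linarith)
      ultimately show ?thesis unfolding \<phi>u by simp
    next
      case False
      have "?h u = l1 + (l2 - l1) + (\<tau> - l1) - u"
        using u False l \<tau> by (intro flip_lift_right_wrap; linarith)
      moreover have "?g (u + l1) = l1 + l2 + \<tau> - (u + l1)"
        using u False l \<tau> by (intro flip_lift_right_wrap; linarith)
      ultimately show ?thesis using u unfolding \<phi>u by (simp add: \<phi>_def p_def)
    qed
  qed
  have near: "?g (?g (?g (\<phi> u))) = \<phi> (?h u)" if "u \<in> C" "u < l1" for u
  proof -
    note u = u(1,2)[OF that(1)] that(2)
    \<comment> \<open>The excursion enters the preimage of \<open>[0, l1)\<close> and then
      \<open>[0, l1)\<close> itself; the two reflections cancel the shift made by
      \<open>\<phi>\<close>.\<close>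
    have "?g (?g (\<phi> u)) = u"
    proof (cases "u < p")
      case True
      have "?g (u - l1 + ?L) = l1 + l2 + \<tau> - (u - l1 + ?L)"
        using u l \<tau> True unfolding p_def by (intro flip_lift_right_wrap; linarith)
      then have "?g (u - l1 + ?L) = l1 + \<tau> - l3 - u" by simp
      moreover have "?g (l1 + \<tau> - l3 - u) = l1 + \<tau> - (l1 + \<tau> - l3 - u) - l3"
        using u l \<tau> True unfolding p_def by (intro flip_lift_middle_wrap; linarith)
      ultimately show ?thesis using True by (simp add: \<phi>_def)
    next
      case False
      \<comment> \<open>At \<open>u = p\<close> the next image would be exactly \<open>L\<close> and
        wrap to 0.\<close>
      then have "p < u" using \<open>u \<in> C\<close> C(4) by (auto simp: less_le)
      have "?g (u + l1) = 2 * l1 + l2 + \<tau> - (u + l1)"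
        using u l \<tau> \<open>p < u\<close> unfolding p_def by (intro flip_lift_middle; linarith)
      then have "?g (u + l1) = l1 + l2 + \<tau> - u" by simp
      moreover have "?g (l1 + l2 + \<tau> - u) = l1 + l2 + \<tau> - (l1 + l2 + \<tau> - u)"
        using u l \<tau> by (intro flip_lift_right_wrap; linarith)
      ultimately show ?thesis using False by (simp add: \<phi>_def)
    qed
    moreover have "?g u = l1 + \<tau> - u"
      using u l \<tau> by (intro flip_lift_left; linarith)
    moreover have "?h u = ?w (\<tau> - u)"
      using u by (simp add: flip_lift_def Let_def)
    moreover have "\<phi> (?w (\<tau> - u)) = \<tau> - u + l1"
      using u l \<tau> unfolding p_def by (intro \<phi>_wrap[unfolded p_def]; linarith)
    ultimately show ?thesis by simp
  qed
  \<comment> \<open>\<open>?D\<close> holds the points of return time 3; \<open>?E\<close> adds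
    their two intermediate iterates.\<close>
  let ?D = "C \<inter> {..<l1}"
  let ?E = "\<phi> ` C \<union> ?g ` \<phi> ` ?D \<union> ?g ` ?g ` \<phi> ` ?D"
  have "?g x \<in> ?E" if x: "x \<in> \<phi> ` C" for x
  proof -
    obtain v where v: "v \<in> C" "x = \<phi> v" using x by blast
    show ?thesis
    proof (cases "v < l1")
      case True then show ?thesis using v by blast
    next
      case False
      then have "?g x = \<phi> (?h v)" using far v u(3)[OF v(1)] by simp
      then show ?thesis using C(5)[OF v(1)] by blast
    qed
  qed
  moreover have "?g x \<in> ?E" if "x \<in> ?g ` ?g ` \<phi> ` ?D" for x
    using that near C(5) by auto
  ultimately have "?g ` ?E \<subseteq> ?E" by blast
  moreover have "?E \<subseteq> {0..<?L}"
  proof -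
    have r: "?g x \<in> {0..<?L}" if "x \<in> {0..<?L}" for x
      using flip_lift_range[of l1 l2 l3 \<tau> x] that l \<tau> by auto
    have "\<phi> v \<in> {0..<?L}" if "v \<in> C" for v
      using u[OF that] l p by (auto simp: \<phi>_def)
    then have "\<phi> v \<in> {0..<?L} \<and> ?g (\<phi> v) \<in> {0..<?L} \<and> ?g (?g (\<phi> v)) \<in> {0..<?L}" if "v \<in> C" for v
      using r that by simp
    then show ?thesis by blast
  qed
  moreover have "?E \<inter> B = {}"
  proof -
    have "\<phi> v \<notin> B \<and> ?g (\<phi> v) \<notin> B \<and> ?g (?g (\<phi> v)) \<notin> B" if "v \<in> C" for v
    proof -
      have "v \<notin> ?B" using C(4)[unfolded disjoint_iff] that by simp
      then show ?thesis by simp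
    qed
    then show ?thesis by blast
  qed
  moreover have "finite ?E" "?E \<noteq> {}" using C(1,2) by auto
  ultimately show "\<exists>C. finite C \<and> C \<noteq> {} \<and> C \<subseteq> {0..<?L} \<and> C \<inter> B = {} \<and> ?g ` C \<subseteq> C"
    by (intro exI[of _ ?E] conjI)
qed

section \<open>Termination of the induction\<close>

text \<open>\<open>d\<close> is fixed separately because rotation and induction both preserve it;
  \<open>n\<close> bounds the length in units of \<open>\<bar>d\<bar>\<close>.\<close>

lemma generic_cycle_exists:
  assumes "l1 \<ge> 0" "l2 \<ge> 0" "l3 \<ge> 0" "0 \<le> \<tau>" "\<tau> \<le> l1 + l2 + l3"
    and "\<tau> - (l1 + l2 + l3) / 2 = d" "d \<noteq> 0"
  shows "generic_cycle \<tau> l1 l2 l3"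
proof -
  have "l1 + l2 + l3 < n * \<bar>d\<bar> \<Longrightarrow> ?thesis" for n :: nat
    using assms(1-6)
  proof (induction n arbitrary: l1 l2 l3 \<tau>)
    case 0
    then show ?case by simp
  next
    case (Suc n)
    note IH = Suc.IH and less = Suc.prems(1)
    \<comment> \<open>\<open>m\<close> is the minimum of \<open>\<tau>\<close> and
      \<open>L - \<tau>\<close>.\<close>
    define m where "m = (l1 + l2 + l3) / 2 - \<bar>d\<bar>"
    have m: "m < \<tau> \<and> m = l1 + l2 + l3 - \<tau> \<or> m = \<tau> \<and> m < l1 + l2 + l3 - \<tau>"
      using Suc.prems(7) \<open>d \<noteq> 0\<close> by (auto simp: m_def abs_if field_simps)
    have least: "generic_cycle \<tau> a b c"
      if abc: "a \<ge> 0" "b \<ge> 0" "c \<ge> 0" "a + b + c = l1 + l2 + l3" "a \<le> b" "a \<le> c"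
        and short: "b \<le> m" "c \<le> m" for a b c
    proof -
      \<comment> \<open>Two lengths of at most \<open>L/2 - \<bar>d\<bar>\<close> leave at least
        \<open>2 * \<bar>d\<bar>\<close> for the third.\<close>
      have a: "a \<ge> 2 * \<bar>d\<bar>" using abc(4) short unfolding m_def by argo
      then have "a > 0" using \<open>d \<noteq> 0\<close> by linarith
      have \<tau>: "c \<le> \<tau>" "\<tau> \<le> a + c" using m short abc(4) by argo+
      have "generic_cycle (\<tau> - a) a (b - a) (c - a)"
      proof (rule IH)
        show "a + (b - a) + (c - a) < n * \<bar>d\<bar>"
          using less a abc by (simp add: algebra_simps)
        show "\<tau> - a - (a + (b - a) + (c - a)) / 2 = d"
          using Suc.prems(7) abc(4) by (simp add: field_simps)
        show "0 \<le> a" "0 \<le> b - a" "0 \<le> c - a" using abc by simp_all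
        show "0 \<le> \<tau> - a" "\<tau> - a \<le> a + (b - a) + (c - a)" using abc(5,6) \<tau> by simp_all
      qed
      with \<open>a > 0\<close> abc(5,6) \<tau> show ?thesis by (rule generic_cycle_induced)
    qed
    have long: "generic_cycle \<tau> a b c"
      if "a \<ge> 0" "b \<ge> 0" "c \<ge> 0" "a + b + c = l1 + l2 + l3" "a > m" for a b c
    proof (rule generic_cycle_long_interval)
      show "a > \<tau> \<or> a > a + b + c - \<tau>" using that(4,5) m by argo
    qed (use that Suc.prems(5,6) in simp_all)
    have any: "generic_cycle \<tau> a b c"
      if "a \<ge> 0" "b \<ge> 0" "c \<ge> 0" "a + b + c = l1 + l2 + l3" "a > m \<or> a \<le> b \<and> a \<le> c \<and> b \<le> m \<and> c \<le> m"
      for a b c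
      using that(5) least[OF that(1-4)] long[OF that(1-4)] by blast
    \<comment> \<open>A long interval or, failing that, a shortest one is brought to the front by
      rotation.\<close>
    consider "l1 > m \<or> l1 \<le> l2 \<and> l1 \<le> l3 \<and> l2 \<le> m \<and> l3 \<le> m"
      | "l2 > m \<or> l2 \<le> l3 \<and> l2 \<le> l1 \<and> l3 \<le> m \<and> l1 \<le> m"
      | "l3 > m \<or> l3 \<le> l1 \<and> l3 \<le> l2 \<and> l1 \<le> m \<and> l2 \<le> m"
      by argo
    then show ?case
    proof cases
      case 1
      then show ?thesis using any Suc.prems by simp
    next
      case 2
      then have "generic_cycle \<tau> l2 l3 l1" using any Suc.prems by simp
      from generic_cycle_rotate[OF _ _ _ _ _ this] show ?thesis
        using Suc.prems by simp
    next
      case 3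
      then have "generic_cycle \<tau> l3 l1 l2" using any Suc.prems by simp
      from generic_cycle_rotate[OF _ _ _ _ _ this] have "generic_cycle \<tau> l2 l3 l1"
        using Suc.prems by simp
      from generic_cycle_rotate[OF _ _ _ _ _ this] show ?thesis
        using Suc.prems by simp
    qed
  qed
  moreover obtain n :: nat where "l1 + l2 + l3 < n * \<bar>d\<bar>"
    using \<open>d \<noteq> 0\<close> reals_Archimedean3[of "\<bar>d\<bar>"] by auto
  ultimately show ?thesis by blast
qed

section \<open>Transfer to the circle\<close>

text \<open>An injective map permutes a finite invariant set, so backward iterates cannot leave it
  either.\<close>

lemma orbit_of_subset_finite_invariant:
  assumes "inj f" "finite G" "f ` G \<subseteq> G" "x \<in> G"
  shows "orbit_of f x \<subseteq> G"
proof
  fix y assume "y \<in> orbit_of f x"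
  then obtain n where n: "y = (f ^^ n) x \<or> x = (f ^^ n) y" by (auto simp: orbit_of_def)
  have "f ` G = G" using assms by (meson endo_inj_surj inj_on_subset subset_UNIV)
  then have pow: "(f ^^ n) ` G = G"
    by (induction n) (simp, metis funpow.simps(2) image_comp)
  from n show "y \<in> G"
  proof
    assume "x = (f ^^ n) y"
    then have "(f ^^ n) y \<in> (f ^^ n) ` G" using pow assms(4) by simp
    then show ?thesis using inj_image_mem_iff[OF inj_fn[OF assms(1), of n]] by blast
  qed (use pow assms(4) in blast)
qed

text \<open>Closedness in the quotient topology is tested on the preimage, here a union of integer
  translates.\<close>

lemma to_circle_vimage_image: "to_circle -` to_circle ` C = (\<Union>c\<in>C. (+) c ` \<int>)"
proof (intro equalityI subsetI)
  fix x assume "x \<in> to_circle -` to_circle ` C"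
  then obtain c where "c \<in> C" "x - c \<in> \<int>" by (auto simp: to_circle_eq_iff)
  then show "x \<in> (\<Union>c\<in>C. (+) c ` \<int>)" by (auto intro!: bexI[of _ c] image_eqI[of _ _ "x - c"])
next
  fix x assume "x \<in> (\<Union>c\<in>C. (+) c ` \<int>)"
  then obtain c k where "c \<in> C" "k \<in> \<int>" "x = c + k" by blast
  then show "x \<in> to_circle -` to_circle ` C"
    by (auto intro!: image_eqI[of _ _ c] simp: to_circle_eq_iff)
qed

lemma closed_to_circle_finite:
  assumes "finite C"
  shows "closed (to_circle ` C)"
proof -
  have "closed (to_circle -` to_circle ` C)"
    unfolding to_circle_vimage_image using assms
    by (intro closed_UN) (auto intro: closed_translation)
  then show ?thesis
    by (simp add: closed_def open_circle_def vimage_Compl)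
qed

lemma to_circle_finite_neq_UNIV:
  assumes "finite C"
  shows "to_circle ` C \<noteq> UNIV"
proof
  assume "to_circle ` C = UNIV"
  then have "(UNIV :: real set) = (\<Union>c\<in>C. (+) c ` \<int>)"
    using to_circle_vimage_image[of C] by simp
  moreover have "countable (\<Union>c\<in>C. (+) c ` (\<int> :: real set))"
    using assms by (intro countable_UN) (auto simp: countable_finite Ints_def)
  ultimately show False using uncountable_UNIV_real by simp
qed

lemma flip_iet_to_circle:
  assumes "l1 + l2 + l3 = 1" "x \<in> {0..<1}"
  shows "flip_iet \<tau> l1 l2 l3 (to_circle x) = to_circle (flip_lift \<tau> l1 l2 l3 x)"
  using assms by (auto simp: flip_iet_def flip_lift_def Let_def unit_rep_to_circle to_circle_eq_iff)

theorem theorem3: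
  fixes l1 l2 l3 \<tau> :: real
  assumes "l1 > 0" and "l2 > 0" and "l3 > 0" and "l1 + l2 + l3 = 1"
    and "\<tau> \<in> {0..<1}"
    and "minimal_off (singular_points l1 l2 l3) (flip_iet \<tau> l1 l2 l3)"
  shows "\<tau> = 1/2"
proof (rule ccontr)
  assume "\<tau> \<noteq> 1/2"
  then have "generic_cycle \<tau> l1 l2 l3"
    using assms by (intro generic_cycle_exists[where d = "\<tau> - 1/2"]) auto
  \<comment> \<open>Avoiding the interval ends keeps the cycle off the singular points, so
    minimality would make a finite, hence closed, set dense.\<close>
  then obtain C where C: "finite C" "C \<noteq> {}" "C \<subseteq> {0..<1}" "C \<inter> {0, l1, l1 + l2} = {}"
    "\<And>x. x \<in> C \<Longrightarrow> flip_lift \<tau> l1 l2 l3 x \<in> C"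
    using generic_cycleD[of \<tau> l1 l2 l3 "{0, l1, l1 + l2}"] assms(4)
    by (metis countable_empty countable_insert)
  from C(2) obtain x where x: "x \<in> C" by blast
  let ?F = "flip_iet \<tau> l1 l2 l3" and ?G = "to_circle ` C"
  have "?F (to_circle y) \<in> ?G" if "y \<in> C" for y
    using that C(3) C(5)[OF that] by (subst flip_iet_to_circle[OF assms(4)]) auto
  then have "?F ` ?G \<subseteq> ?G" by blast
  moreover have "inj ?F" using bij_flip_iet[OF assms(1-4)] by (rule bij_is_inj)
  ultimately have orbit: "orbit_of ?F (to_circle x) \<subseteq> ?G"
    using C(1) x by (intro orbit_of_subset_finite_invariant) auto
  have "to_circle 1 = to_circle 0" by (simp add: to_circle_eq_iff)
  then have "singular_points l1 l2 l3 = to_circle ` {0, l1, l1 + l2}"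
    by (auto simp: singular_points_def atLeastAtMost_def numeral_3_eq_3 numeral_2_eq_2
        atMost_Suc endpt_def)
  moreover have "inj_on to_circle {0..<1}"
    by (rule inj_on_inverseI[of _ unit_rep]) (simp add: unit_rep_to_circle)
  ultimately have "?G \<inter> singular_points l1 l2 l3 = {}"
    using C(3,4) assms(1-4) inj_on_image_Int[of to_circle "{0..<1}" C "{0, l1, l1 + l2}"] by auto
  then have "orbit_of ?F (to_circle x) \<inter> singular_points l1 l2 l3 = {}"
    using orbit by blast
  then have "closure (orbit_of ?F (to_circle x)) = UNIV"
    using assms(6) by (simp add: minimal_off_def)
  moreover have "closure (orbit_of ?F (to_circle x)) \<subseteq> ?G"
    using orbit closed_to_circle_finite[OF C(1)] by (rule closure_minimal)
  ultimately show False using to_circle_finite_neq_UNIV[OF C(1)] by blast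
qed

end
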